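(* For all integers $n\ge 0$ and $m\ge 3$: (a) $\widehat{T}_{m+n}=T_{m-1}\widehat{T}_{n+2}+(T_{m-2}+T_{m-3})\widehat{T}_{n+1}+T_{m-2}\widehat{T}_n$; (b) $\widehat{T}_{m+n}=T_{m+2}\widehat{T}_{n-1}+(T_{m+1}+T_m)\widehat{T}_{n-2}+T_{m+1}\widehat{T}_{n-3}$; (c) $\widehat{K}_{m+n}=K_{n-1}\widehat{T}_{m+2}+(\widehat{T}_{m+1}+\widehat{T}_m)K_{n-2}+K_{n-3}\widehat{T}_{m+1}$; (d) $\widehat{K}_{m+n}=K_{m+2}\widehat{T}_{n-1}+(K_{m+1}+K_m)\widehat{T}_{n-2}+K_{m+1}\widehat{T}_{n-3}$.
   Context: The Tribonacci numbers are $T_n=T_{n-1}+T_{n-2}+T_{n-3}$ with $T_0=0,T_1=1,T_2=1$, and the Tribonacci-Lucas numbers are $K_n=K_{n-1}+K_{n-2}+K_{n-3}$ with $K_0=3,K_1=1,K_2=3$; both are extended to negative indices so that the recurrences hold for all integers $n$. The sedenions $\mathbb{S}$ are the 16-dimensional real Cayley-Dickson algebra (the double of the octonions) with standard basis $e_0,e_1,\dots,e_{15}$, $e_0=1$ the identity; addition and multiplication by scalars are componentwise. For every integer $n$ (including negative $n$), $\widehat{T}_n=\sum_{s=0}^{15}T_{n+s}e_s$ and $\widehat{K}_n=\sum_{s=0}^{15}K_{n+s}e_s$. *)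

theory Defs
  imports Complex_Main
begin

text \<open>
  The Tribonacci recurrence with arbitrary initial values, on all of the integers:
  negative indices are obtained by solving the recurrence for its lowest term.
\<close>

function trib_seq :: "int \<Rightarrow> int \<Rightarrow> int \<Rightarrow> int \<Rightarrow> int" where
  "trib_seq a b c n =
     (if n = 0 then a
      else if n = 1 then b
      else if n = 2 then c
      else if n > 2
        then trib_seq a b c (n - 1) + trib_seq a b c (n - 2) + trib_seq a b c (n - 3)
      else trib_seq a b c (n + 3) - trib_seq a b c (n + 2) - trib_seq a b c (n + 1))"
  by pat_completeness auto
termination
  by (relation "measure (\<lambda>(a, b, c, n).
        nat (if 0 \<le> n \<and> n \<le> 2 then 0 else if n > 2 then n else 1 - n))") auto

declare trib_seq.simps [simp del]

definition T :: "int \<Rightarrow> int" where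
  "T = trib_seq 0 1 1"

definition K :: "int \<Rightarrow> int" where
  "K = trib_seq 3 1 3"

lemma trib_seq_rec:
  "trib_seq a b c n = trib_seq a b c (n - 1) + trib_seq a b c (n - 2) + trib_seq a b c (n - 3)"
proof (cases "n > 2")
  case True
  then show ?thesis
    by (subst trib_seq.simps) simp
next
  case False
  then show ?thesis
    by (subst (4) trib_seq.simps) simp
qed

lemma T_initial: "T 0 = 0" "T 1 = 1" "T 2 = 1"
  by (simp_all add: T_def trib_seq.simps)

lemma T_rec: "T n = T (n - 1) + T (n - 2) + T (n - 3)"
  unfolding T_def by (rule trib_seq_rec)

lemma K_initial: "K 0 = 3" "K 1 = 1" "K 2 = 3"
  by (simp_all add: K_def trib_seq.simps)

lemma K_rec: "K n = K (n - 1) + K (n - 2) + K (n - 3)"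
  unfolding K_def by (rule trib_seq_rec)

text \<open>
  Algebras with conjugation to which the Cayley-Dickson doubling can be applied. No associativity
  or commutativity is assumed. \<open>cd_basis s\<close> is the standard basis vector with index
  \<open>s < cd_dim TYPE('a)\<close>.
\<close>

class cayley_dickson = real_vector + mult_zero + one +
  fixes cd_conj :: "'a \<Rightarrow> 'a"
    and cd_dim :: "'a itself \<Rightarrow> nat"
    and cd_basis :: "nat \<Rightarrow> 'a"
  assumes cd_one_mult [simp]: "1 * x = x"
    and cd_mult_one [simp]: "x * 1 = x"
    and cd_conj_zero [simp]: "cd_conj 0 = 0"
    and cd_conj_one [simp]: "cd_conj 1 = 1"
    and cd_dim_pos [simp]: "cd_dim TYPE('a) > 0"
    and cd_basis_0 [simp]: "cd_basis 0 = 1"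

instantiation real :: cayley_dickson
begin

definition "cd_conj (x :: real) = x"
definition "cd_dim (_ :: real itself) = 1"
definition "cd_basis s = (if s = 0 then 1 else 0 :: real)"

instance
  by standard (simp_all add: cd_conj_real_def cd_dim_real_def cd_basis_real_def)

end

datatype 'a cd = CD (cd_fst: 'a) (cd_snd: 'a)

instantiation cd :: (real_vector) real_vector
begin

definition "0 = CD 0 0"
definition "x + y = CD (cd_fst x + cd_fst y) (cd_snd x + cd_snd y)"
definition "x - y = CD (cd_fst x - cd_fst y) (cd_snd x - cd_snd y)"
definition "- x = CD (- cd_fst x) (- cd_snd x)"
definition "r *\<^sub>R x = CD (r *\<^sub>R cd_fst x) (r *\<^sub>R cd_snd x)"

instance
  by standard
    (simp_all add: zero_cd_def plus_cd_def minus_cd_def uminus_cd_def scaleR_cd_def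
      algebra_simps)

end

text \<open>
  The doubling product is \<open>(a, b) (c, d) = (a c - d\<^sup>* b, d a + b c\<^sup>*)\<close>; the basis of the double
  consists of the vectors \<open>(e\<^sub>s, 0)\<close> followed by the vectors \<open>(0, e\<^sub>s)\<close>.
\<close>

instantiation cd :: (cayley_dickson) cayley_dickson
begin

definition "1 = CD 1 0"
definition "x * y =
  CD (cd_fst x * cd_fst y - cd_conj (cd_snd y) * cd_snd x)
     (cd_snd y * cd_fst x + cd_snd x * cd_conj (cd_fst y))"
definition "cd_conj x = CD (cd_conj (cd_fst x)) (- cd_snd x)"
definition "cd_dim (_ :: 'a cd itself) = 2 * cd_dim TYPE('a)"
definition "cd_basis s =
  (if s < cd_dim TYPE('a) then CD (cd_basis s) 0 else CD 0 (cd_basis (s - cd_dim TYPE('a))))"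

instance
  by standard
    (simp_all add: one_cd_def times_cd_def cd_conj_cd_def cd_dim_cd_def cd_basis_cd_def
      zero_cd_def)

end

type_synonym quaternion = "real cd cd"
type_synonym octonion = "quaternion cd"
type_synonym sedenion = "octonion cd"

abbreviation sed_e :: "nat \<Rightarrow> sedenion" where
  "sed_e \<equiv> cd_basis"

lemma cd_dim_sedenion: "cd_dim TYPE(sedenion) = 16"
  by (simp add: cd_dim_cd_def cd_dim_real_def)

lemma sed_e_0_identity: "sed_e 0 = 1" "1 * x = x" "x * 1 = x" for x :: sedenion
  by simp_all

definition T_hat :: "int \<Rightarrow> sedenion" where
  "T_hat n = (\<Sum>s = 0..15. real_of_int (T (n + int s)) *\<^sub>R sed_e s)"

definition K_hat :: "int \<Rightarrow> sedenion" where
  "K_hat n = (\<Sum>s = 0..15. real_of_int (K (n + int s)) *\<^sub>R sed_e s)"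

end

theory Submission
  imports Defs
begin

text \<open>
  The solutions of the Tribonacci recurrence on the integers form a module of rank three: a solution
  is determined by three consecutive values. For a solution \<open>U\<close>, its shift
  \<open>U (i + j)\<close>, seen as a function of \<open>i\<close>, is therefore the combination of shifts of \<open>T\<close> that has
  the values \<open>U j\<close>, \<open>U (j + 1)\<close>, \<open>U (j + 2)\<close> at \<open>i = 0, 1, 2\<close>. This is the addition formula
  \<open>tribonacci_addition\<close>. The sedenion identities are linear in
  the basis vectors, so each holds because its \<open>s\<close>-th coordinate is an instance of the
  addition formula, with \<open>s\<close> absorbed into \<open>j\<close> when the hatted terms on the right-hand side sit at
  the indices near \<open>j\<close>, and into \<open>i\<close> when they are the shifts of \<open>T\<close> near \<open>i\<close>.
\<close>

text \<open>
  The recurrence can be run in both directions, so three zeros spread over the whole line.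
  Applied to a difference, this is the uniqueness of the solution with given initial values.
\<close>

lemma tribonacci_recurrence_eq_zero:
  fixes D :: "int \<Rightarrow> int"
  assumes rec: "\<And>i. D i = D (i - 1) + D (i - 2) + D (i - 3)"
    and init: "D 0 = 0" "D 1 = 0" "D 2 = 0"
  shows "D i = 0"
proof -
  have "D i = 0 \<and> D (i + 1) = 0 \<and> D (i + 2) = 0"
  proof (induction i rule: int_induct[where k = 0])
    case base
    show ?case using init by simp
  next
    case (step1 i)
    then show ?case using rec[of "i + 3"] by (simp add: algebra_simps)
  next
    case (step2 i)
    then show ?case using rec[of "i + 2"] by (simp add: algebra_simps)
  qed
  then show ?thesis by simp
qed

text \<open>
  Both sides solve the recurrence in \<open>i\<close>. At \<open>i = 0, 1, 2\<close> the three coefficients on the right are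
  \<open>0, 0, 1\<close>, then \<open>0, 1, 0\<close>, then \<open>1, 0, 0\<close>.
\<close>

lemma tribonacci_addition:
  fixes U :: "int \<Rightarrow> int"
  assumes rec: "\<And>i. U i = U (i - 1) + U (i - 2) + U (i - 3)"
  shows "U (i + j) =
    T (i - 1) * U (j + 2) + (T (i - 2) + T (i - 3)) * U (j + 1) + T (i - 2) * U j"
proof -
  define D where "D i = U (i + j)
    - (T (i - 1) * U (j + 2) + (T (i - 2) + T (i - 3)) * U (j + 1) + T (i - 2) * U j)" for i
  have T_negative: "T (- 1) = 0" "T (- 2) = 1" "T (- 3) = - 1"
    using T_rec[of 2] T_rec[of 1] T_rec[of 0] by (simp_all add: T_initial)
  have "D i = D (i - 1) + D (i - 2) + D (i - 3)" for i
  proof -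
    have "U (i + j) = U (i - 1 + j) + U (i - 2 + j) + U (i - 3 + j)"
      using rec[of "i + j"] by (simp add: algebra_simps)
    moreover have "T (i - 1) = T (i - 1 - 1) + T (i - 2 - 1) + T (i - 3 - 1)"
      using T_rec[of "i - 1"] by (simp add: algebra_simps)
    moreover have "T (i - 2) = T (i - 1 - 2) + T (i - 2 - 2) + T (i - 3 - 2)"
      using T_rec[of "i - 2"] by (simp add: algebra_simps)
    moreover have "T (i - 3) = T (i - 1 - 3) + T (i - 2 - 3) + T (i - 3 - 3)"
      using T_rec[of "i - 3"] by (simp add: algebra_simps)
    ultimately show ?thesis
      unfolding D_def by algebra
  qed
  moreover have "D 0 = 0" "D 1 = 0" "D 2 = 0"
    by (simp_all add: D_def T_initial T_negative add.commute)
  ultimately have "D i = 0"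
    by (rule tribonacci_recurrence_eq_zero)
  then show ?thesis by (simp add: D_def)
qed

lemmas T_addition = tribonacci_addition[of T, OF T_rec]
lemmas K_addition = tribonacci_addition[of K, OF K_rec]

text \<open>
  The reduction to coordinates, for any real vector space in place of the sedenions.
\<close>

lemma sum_scaleR_combination:
  fixes a b c :: int and F X Y Z :: "nat \<Rightarrow> int" and e :: "nat \<Rightarrow> 'a::real_vector"
  assumes "\<And>s. F s = a * X s + b * Y s + c * Z s"
  shows "(\<Sum>s\<in>A. real_of_int (F s) *\<^sub>R e s) =
    real_of_int a *\<^sub>R (\<Sum>s\<in>A. real_of_int (X s) *\<^sub>R e s)
    + real_of_int b *\<^sub>R (\<Sum>s\<in>A. real_of_int (Y s) *\<^sub>R e s)
    + real_of_int c *\<^sub>R (\<Sum>s\<in>A. real_of_int (Z s) *\<^sub>R e s)"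
  by (simp add: assms scaleR_sum_right sum.distrib scaleR_add_left)

lemma T_hat_add:
  "T_hat i + T_hat j =
    (\<Sum>s = 0..15. real_of_int (T (i + int s) + T (j + int s)) *\<^sub>R sed_e s)"
  by (simp add: T_hat_def sum.distrib scaleR_add_left)

theorem theorem3p2:
  fixes m n :: int
  assumes "n \<ge> 0" and "m \<ge> 3"
  shows "(T_hat (m + n) =
           real_of_int (T (m - 1)) *\<^sub>R T_hat (n + 2)
           + real_of_int (T (m - 2) + T (m - 3)) *\<^sub>R T_hat (n + 1)
           + real_of_int (T (m - 2)) *\<^sub>R T_hat n)
         \<and> (T_hat (m + n) =
           real_of_int (T (m + 2)) *\<^sub>R T_hat (n - 1)
           + real_of_int (T (m + 1) + T m) *\<^sub>R T_hat (n - 2)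
           + real_of_int (T (m + 1)) *\<^sub>R T_hat (n - 3))
         \<and> (K_hat (m + n) =
           real_of_int (K (n - 1)) *\<^sub>R T_hat (m + 2)
           + real_of_int (K (n - 2)) *\<^sub>R (T_hat (m + 1) + T_hat m)
           + real_of_int (K (n - 3)) *\<^sub>R T_hat (m + 1))
         \<and> (K_hat (m + n) =
           real_of_int (K (m + 2)) *\<^sub>R T_hat (n - 1)
           + real_of_int (K (m + 1) + K m) *\<^sub>R T_hat (n - 2)
           + real_of_int (K (m + 1)) *\<^sub>R T_hat (n - 3))"
proof (intro conjI)
  show "T_hat (m + n) =
           real_of_int (T (m - 1)) *\<^sub>R T_hat (n + 2)
           + real_of_int (T (m - 2) + T (m - 3)) *\<^sub>R T_hat (n + 1)
           + real_of_int (T (m - 2)) *\<^sub>R T_hat n"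
    unfolding T_hat_def
  proof (rule sum_scaleR_combination)
    fix s
    show "T (m + n + int s) = T (m - 1) * T (n + 2 + int s)
        + (T (m - 2) + T (m - 3)) * T (n + 1 + int s) + T (m - 2) * T (n + int s)"
      using T_addition[of m "n + int s"] by (simp add: algebra_simps)
  qed
  show "T_hat (m + n) =
           real_of_int (T (m + 2)) *\<^sub>R T_hat (n - 1)
           + real_of_int (T (m + 1) + T m) *\<^sub>R T_hat (n - 2)
           + real_of_int (T (m + 1)) *\<^sub>R T_hat (n - 3)"
    unfolding T_hat_def
  proof (rule sum_scaleR_combination)
    fix s
    show "T (m + n + int s) = T (m + 2) * T (n - 1 + int s)
        + (T (m + 1) + T m) * T (n - 2 + int s) + T (m + 1) * T (n - 3 + int s)"
      using T_addition[of "m + 3" "n - 3 + int s"] by (simp add: algebra_simps)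
  qed
  show "K_hat (m + n) =
           real_of_int (K (n - 1)) *\<^sub>R T_hat (m + 2)
           + real_of_int (K (n - 2)) *\<^sub>R (T_hat (m + 1) + T_hat m)
           + real_of_int (K (n - 3)) *\<^sub>R T_hat (m + 1)"
    unfolding T_hat_add unfolding K_hat_def T_hat_def
  proof (rule sum_scaleR_combination)
    fix s
    show "K (m + n + int s) = K (n - 1) * T (m + 2 + int s)
        + K (n - 2) * (T (m + 1 + int s) + T (m + int s)) + K (n - 3) * T (m + 1 + int s)"
      using K_addition[of "m + 3 + int s" "n - 3"] by (simp add: algebra_simps)
  qed
  show "K_hat (m + n) =
           real_of_int (K (m + 2)) *\<^sub>R T_hat (n - 1)
           + real_of_int (K (m + 1) + K m) *\<^sub>R T_hat (n - 2)
           + real_of_int (K (m + 1)) *\<^sub>R T_hat (n - 3)"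
    unfolding K_hat_def T_hat_def
  proof (rule sum_scaleR_combination)
    fix s
    \<comment> \<open>The addition formula groups by the index of \<open>K\<close>; here its term
      \<open>K (m + 1) * T (n - 2 + s)\<close> is moved next to \<open>K m * T (n - 2 + s)\<close>.\<close>
    show "K (m + n + int s) = K (m + 2) * T (n - 1 + int s)
        + (K (m + 1) + K m) * T (n - 2 + int s) + K (m + 1) * T (n - 3 + int s)"
      using K_addition[of "n + int s" m] by (simp add: algebra_simps)
  qed
qed

end
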